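(* Let $G$ be a graph (finite or infinite) and $o$ a vertex of $G$. The function $x\mapsto L(x,o,G)$, defined for all $x>0$ such that $Z_{o,G}(x)<\infty$, is non-decreasing.
   Context: A path $\omega=(\omega_0,\dots,\omega_m)$ in a graph $G$ is a sequence of vertices with $\omega_j$ adjacent to $\omega_{j+1}$ for all $j<m$; its length is $|\omega|=m$. It is self-avoiding if its vertices are pairwise distinct. $\mathsf{SAW}(o,G)$ is the set of finite self-avoiding paths in $G$ starting at $o$ (including the path of length $0$). For real $x>0$ set $Z_{o,G}(x)=\sum_{\omega\in \mathsf{SAW}(o,G)}x^{|\omega|}$. When this is finite, let $\mathbb{P}_{x,o,G}$ be the probability measure on $\mathsf{SAW}(o,G)$ with $\mathbb{P}_{x,o,G}[\omega]=x^{|\omega|}/Z_{o,G}(x)$, and let $L(x,o,G)$ be the expectation of $|\omega|$ under $\mathbb{P}_{x,o,G}$. *)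

theory Defs
  imports
    "HOL-Probability.Probability"
    "Graph_Theory.Pair_Digraph"
    "Graph_Theory.Vertex_Walk"
begin

text \<open>
  A simple undirected graph, finite or infinite, is a \<open>pair_bidirected_digraph\<close>: a vertex set with an
  irreflexive symmetric set of ordered pairs of vertices, without any finiteness assumption (unlike
  the locale \<open>pair_graph\<close>).  A self-avoiding path is a \<open>vpath\<close>, i.e. a nonempty list of pairwise
  distinct vertices whose consecutive entries are adjacent; its length \<open>vwalk_length\<close> is the number
  of steps, one less than the length of the list.
\<close>

definition SAW :: "'a \<Rightarrow> 'a pair_pre_digraph \<Rightarrow> 'a vwalk set" where
  "SAW r G = {\<omega>. vpath \<omega> (with_proj G) \<and> hd \<omega> = r}"

text \<open>
  The partition function takes values in the extended nonnegative reals, so that divergence of the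
  series is expressed by the value \<open>\<infinity>\<close>; integration against the counting measure is (possibly
  uncountable) summation.
\<close>

definition saw_Z :: "'a \<Rightarrow> 'a pair_pre_digraph \<Rightarrow> real \<Rightarrow> ennreal" where
  "saw_Z r G x = (\<integral>\<^sup>+ \<omega>. ennreal (x ^ vwalk_length \<omega>) \<partial>count_space (SAW r G))"

definition saw_measure :: "real \<Rightarrow> 'a \<Rightarrow> 'a pair_pre_digraph \<Rightarrow> 'a vwalk measure" where
  "saw_measure x r G =
     density (count_space (SAW r G)) (\<lambda>\<omega>. ennreal (x ^ vwalk_length \<omega>) / saw_Z r G x)"

text \<open>
  The expected length may be infinite even though the partition function is finite (this can only
  happen at the radius of convergence), hence the extended codomain and the nonnegative integral;
  the Bochner integral would give the junk value 0 there.
\<close>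

definition saw_L :: "real \<Rightarrow> 'a \<Rightarrow> 'a pair_pre_digraph \<Rightarrow> ennreal" where
  "saw_L x r G = (\<integral>\<^sup>+ \<omega>. of_nat (vwalk_length \<omega>) \<partial>saw_measure x r G)"

lemma singleton_in_SAW: "r \<in> pverts G \<Longrightarrow> [r] \<in> SAW r G"
  by (auto simp: SAW_def vpath_def vwalk_def)

lemma emeasure_saw_measure_singleton:
  assumes "\<omega> \<in> SAW r G"
  shows "emeasure (saw_measure x r G) {\<omega>} = ennreal (x ^ vwalk_length \<omega>) / saw_Z r G x"
  using assms unfolding saw_measure_def
  by (subst emeasure_density)
     (auto simp del: vwalk_length_simp simp: nn_integral_indicator_singleton)

lemma saw_Z_ge_1:
  assumes "r \<in> pverts G"
  shows "1 \<le> saw_Z r G x"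
proof -
  have "1 = (\<integral>\<^sup>+ \<omega>. indicator {[r]} \<omega> \<partial>count_space (SAW r G))"
    using singleton_in_SAW[OF assms] by simp
  also have "\<dots> \<le> saw_Z r G x"
    unfolding saw_Z_def by (intro nn_integral_mono) (auto simp: indicator_def)
  finally show ?thesis .
qed

lemma prob_space_saw_measure:
  assumes "r \<in> pverts G" and "saw_Z r G x < \<infinity>"
  shows "prob_space (saw_measure x r G)"
proof
  have "emeasure (saw_measure x r G) (space (saw_measure x r G)) =
      (\<integral>\<^sup>+ \<omega>. ennreal (x ^ vwalk_length \<omega>) / saw_Z r G x \<partial>count_space (SAW r G))"
    unfolding saw_measure_def
    by (subst emeasure_density)
       (auto simp del: vwalk_length_simp intro!: nn_integral_cong simp: indicator_def)
  also have "\<dots> = saw_Z r G x / saw_Z r G x"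
    by (subst nn_integral_divide) (simp_all add: saw_Z_def del: vwalk_length_simp)
  also have "\<dots> = 1"
    using saw_Z_ge_1[OF assms(1), of x] assms(2)
    by (intro ennreal_divide_self) auto
  finally show "emeasure (saw_measure x r G) (space (saw_measure x r G)) = 1" .
qed

end

theory Submission
  imports Defs
begin

text \<open>
  The expected length is a quotient \<open>A(x) / Z(x)\<close> with \<open>A(x) = \<Sum>\<omega>. |\<omega>| * x ^ |\<omega>|\<close>, so for
  \<open>x \<le> y\<close> the claim is the cross-multiplied inequality \<open>A(x) * Z(y) \<le> A(y) * Z(x)\<close>.  The
  measures form an exponential family in the length, and larger parameters favour larger lengths;
  the inequality is Chebyshev's correlation argument.  Write both products as double sums over
  pairs \<open>(\<omega>, \<eta>)\<close> of paths with lengths \<open>(m, n)\<close> and add to each the double sum in which the pair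
  is exchanged.  The summands of the right and the left side then differ by
  \<open>(m - n) * (y ^ m * x ^ n - x ^ m * y ^ n)\<close>, which is nonnegative because the likelihood ratio
  \<open>(y / x) ^ m\<close> is nondecreasing in \<open>m\<close> (lemmas \<open>power_exchange_mono\<close> and
  \<open>nn_integral_ratio_mono\<close>).

  All sums stay in the extended nonnegative reals.  This matters at the radius of convergence, where
  \<open>Z\<close> may be finite while \<open>A\<close> is infinite: no subtraction of possibly infinite sums takes place.
\<close>

lemma power_exchange_mono:
  fixes x y :: real
  assumes "0 \<le> x" and "x \<le> y" and "m \<le> n"
  shows "x ^ n * y ^ m \<le> y ^ n * x ^ m"
proof -
  obtain k where n: "n = m + k"
    using \<open>m \<le> n\<close> le_Suc_ex by blast
  have "x ^ n * y ^ m = (x * y) ^ m * x ^ k"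
    by (simp add: n power_add power_mult_distrib)
  also have "\<dots> \<le> (x * y) ^ m * y ^ k"
    using assms by (intro mult_left_mono power_mono) auto
  also have "\<dots> = y ^ n * x ^ m"
    by (simp add: n power_add power_mult_distrib)
  finally show ?thesis .
qed

text \<open>
  With the factors collected this says
  \<open>0 \<le> (m - n) * (y ^ m * x ^ n - x ^ m * y ^ n)\<close>, where the factors never have opposite signs.
  Expanded without subtraction, it transfers to the extended nonnegative reals.
\<close>

lemma weighted_power_exchange:
  fixes x y :: real
  assumes "0 \<le> x" and "x \<le> y"
  shows "real m * x ^ m * y ^ n + real n * x ^ n * y ^ m
       \<le> real m * y ^ m * x ^ n + real n * y ^ n * x ^ m"
proof -
  have "0 \<le> (real m - real n) * (y ^ m * x ^ n - x ^ m * y ^ n)"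
  proof (cases "m \<le> n")
    case True
    then show ?thesis
      using power_exchange_mono[OF assms, of m n]
      by (intro mult_nonpos_nonpos) (auto simp: mult.commute)
  next
    case False
    then show ?thesis
      using power_exchange_mono[OF assms, of n m]
      by (intro mult_nonneg_nonneg) (auto simp: mult.commute)
  qed
  then show ?thesis
    by (simp add: algebra_simps)
qed

text \<open>
  Exchanging the two points of a pair does not change a double integral whose integrand is a sum of
  products, because each summand factorises into two single integrals.  Unlike an application of
  Fubini's theorem, this is valid on every measure space, sigma-finite or not.
\<close>

lemma nn_integral_ratio_mono:
  fixes f u v :: "'a \<Rightarrow> ennreal"
  assumes [measurable]: "f \<in> borel_measurable M" "u \<in> borel_measurable M" "v \<in> borel_measurable M"
    and exchange: "\<And>s t. s \<in> space M \<Longrightarrow> t \<in> space M \<Longrightarrow>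
      f s * u s * v t + f t * u t * v s \<le> f s * v s * u t + f t * v t * u s"
  shows "(\<integral>\<^sup>+ s. f s * u s \<partial>M) * (\<integral>\<^sup>+ s. v s \<partial>M) \<le> (\<integral>\<^sup>+ s. f s * v s \<partial>M) * (\<integral>\<^sup>+ s. u s \<partial>M)"
proof -
  have double: "2 * ((\<integral>\<^sup>+ s. f s * g s \<partial>M) * (\<integral>\<^sup>+ s. h s \<partial>M))
      = (\<integral>\<^sup>+ s. \<integral>\<^sup>+ t. f s * g s * h t + f t * g t * h s \<partial>M \<partial>M)"
    if [measurable]: "g \<in> borel_measurable M" "h \<in> borel_measurable M" for g h
    by (simp add: nn_integral_add nn_integral_cmult nn_integral_multc mult_2 mult.commute)
  have "2 * ((\<integral>\<^sup>+ s. f s * u s \<partial>M) * (\<integral>\<^sup>+ s. v s \<partial>M))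
      \<le> 2 * ((\<integral>\<^sup>+ s. f s * v s \<partial>M) * (\<integral>\<^sup>+ s. u s \<partial>M))"
    unfolding double[OF assms(2,3)] double[OF assms(3,2)]
    by (intro nn_integral_mono exchange)
  then show ?thesis
    by (subst (asm) ennreal_mult_le_mult_iff) auto
qed

lemma saw_L_eq_quotient:
  "saw_L x r G =
     (\<integral>\<^sup>+ \<omega>. of_nat (vwalk_length \<omega>) * ennreal (x ^ vwalk_length \<omega>) \<partial>count_space (SAW r G))
       / saw_Z r G x"
  unfolding saw_L_def saw_measure_def
  by (simp add: nn_integral_density nn_integral_divide[symmetric] ennreal_times_divide mult.commute
      del: vwalk_length_simp)

theorem theorem10:
  fixes G :: "'a pair_pre_digraph" and r :: 'a
  assumes "pair_bidirected_digraph G"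
    and "r \<in> pverts G"
  shows "mono_on {x :: real. 0 < x \<and> saw_Z r G x < \<infinity>} (\<lambda>x. saw_L x r G)"
proof (rule mono_onI)
  fix x y :: real
  assume x: "x \<in> {x. 0 < x \<and> saw_Z r G x < \<infinity>}" and y: "y \<in> {x. 0 < x \<and> saw_Z r G x < \<infinity>}"
    and "x \<le> y"
  define A where "A z = (\<integral>\<^sup>+ \<omega>. of_nat (vwalk_length \<omega>) * ennreal (z ^ vwalk_length \<omega>)
    \<partial>count_space (SAW r G))" for z :: real
  have cross: "A x * saw_Z r G y \<le> A y * saw_Z r G x"
    unfolding A_def saw_Z_def
  proof (rule nn_integral_ratio_mono)
    fix \<omega> \<eta> :: "'a list"
    let ?m = "vwalk_length \<omega>" and ?n = "vwalk_length \<eta>"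
    have "ennreal (real ?m * x ^ ?m * y ^ ?n + real ?n * x ^ ?n * y ^ ?m)
        \<le> ennreal (real ?m * y ^ ?m * x ^ ?n + real ?n * y ^ ?n * x ^ ?m)"
      using x \<open>x \<le> y\<close> by (intro ennreal_leI weighted_power_exchange) auto
    then show "of_nat ?m * ennreal (x ^ ?m) * ennreal (y ^ ?n)
          + of_nat ?n * ennreal (x ^ ?n) * ennreal (y ^ ?m)
        \<le> of_nat ?m * ennreal (y ^ ?m) * ennreal (x ^ ?n)
          + of_nat ?n * ennreal (y ^ ?n) * ennreal (x ^ ?m)"
      using x y
      by (simp add: ennreal_plus ennreal_mult ennreal_of_nat_eq_real_of_nat
          del: vwalk_length_simp)
  qed auto
  \<comment> \<open>The path of length 0 contributes 1 to the partition function, so both quotients may be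
    cross-multiplied.\<close>
  have pos: "saw_Z r G z \<noteq> 0" for z
    using saw_Z_ge_1[OF assms(2), of z] by auto
  have "A x / saw_Z r G x = (A x * saw_Z r G y) / saw_Z r G y / saw_Z r G x"
    using pos y by (subst ennreal_mult_divide_eq) auto
  also have "\<dots> \<le> (A y * saw_Z r G x) / saw_Z r G y / saw_Z r G x"
    by (intro divide_right_mono_ennreal cross)
  also have "\<dots> = (A y / saw_Z r G y) * saw_Z r G x / saw_Z r G x"
    by (simp add: ennreal_times_divide mult.commute)
  also have "\<dots> = A y / saw_Z r G y"
    using pos x by (subst ennreal_mult_divide_eq) auto
  finally show "saw_L x r G \<le> saw_L y r G"
    by (simp only: saw_L_eq_quotient A_def)
qed

end
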